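(* For every integer $n\ge 1$ and every integer $k$ with $1\le k\le 2n-1$, the number of paths of $\mathcal{P}_n$ having degree $k$ equals $$ \binom{\min\{n,k\}}{\left\lfloor \frac{k+2}{2}\right\rfloor}. $$
   Context: A (binary) path of length $n$ is a lattice path $P=p_1\cdots p_n$ starting at the origin, each step being an upstep $u=(1,1)$ or a downstep $d=(1,-1)$; $\mathcal{P}_n$ is the set of paths of length $n$ and $\mathbf 1_n=u^n$. A valley of $P$ is the last point of a maximal run of $d$'s: it is either the middle point of an occurrence of $du$, or the endpoint of $P$ when $P$ ends with $d$. Turning a valley into a peak means replacing the corresponding $du$ by $ud$ (or, for a valley at the end of the path, the final $d$ by $u$). The filling of $P$ is the path $\widetilde P$ obtained by (simultaneously) turning every valley of $P$ into a peak; $\widetilde{\mathbf 1_n}=\mathbf 1_n$. For $P\in\mathcal P_n$ put $P^{(0)}=P$ and $P^{(i)}=\widetilde{P^{(i-1)}}$; the degree $\delta(P)$ is the least $k\ge0$ with $P^{(k)}=\mathbf 1_n$. *)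

theory Defs
  imports Main
begin

text \<open>A path starting at the origin is determined by its list of steps:
  \<open>U\<close> stands for the step (1,1) and \<open>D\<close> for the step (1,-1).\<close>

datatype step = U | D

type_synonym path = "step list"

definition paths :: "nat \<Rightarrow> path set" where
  "paths n = {P. length P = n}"

definition ones :: "nat \<Rightarrow> path" where
  "ones n = replicate n U"

text \<open>The points of a path of length n are numbered from 0 to n. The steps
  \<open>P ! (i - 1)\<close> and \<open>P ! i\<close> are those entering and leaving point i.\<close>

definition valley :: "path \<Rightarrow> nat \<Rightarrow> bool" where
  "valley P i \<longleftrightarrow> 1 \<le> i \<and> i \<le> length P \<and> P ! (i - 1) = D \<and>
     (i = length P \<or> P ! i = U)"

text \<open>Step j enters point j + 1 and leaves point j. Turning a valley into a peak makes
  the entering step an upstep and the leaving step, if there is one, a downstep. Points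
  j and j + 1 are never both valleys, so the order of the two tests is irrelevant.\<close>

definition filling :: "path \<Rightarrow> path" where
  "filling P = map (\<lambda>j. if valley P (j + 1) then U
                        else if valley P j then D
                        else P ! j) [0..<length P]"

definition degree :: "path \<Rightarrow> nat" where
  "degree P = (LEAST k. (filling ^^ k) P = ones (length P))"

end

theory Submission
  imports Defs
begin

text \<open>Read the downsteps as particles: filling moves each particle one site to the right if the
  next site is free, and particles leave at the right end. Hence the degree is the time needed to
  empty the path. A particle added at the left end of a path of length n leaves at time n + 1 if it
  is never blocked, and otherwise two time units after the leftmost of the other particles. This
  computes the degree by recursion on the path, and so the number of paths of each degree
  satisfies a recurrence in n, solved by Pascal's rule.\<close>

lemma length_filling [simp]: "length (filling P) = length P"
  by (simp add: filling_def)

lemma filling_Nil: "filling [] = []"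
  by (simp add: filling_def)

lemma filling_D: "filling [D] = [U]"
  by (simp add: filling_def valley_def)

lemma valley_0 [simp]: "\<not> valley P 0"
  by (simp add: valley_def)

lemma valley_Cons_Suc_Suc: "valley (s # P) (Suc (Suc j)) = valley P (Suc j)"
  by (auto simp: valley_def)

text \<open>The excluded case is real: point 1 of \<open>D # P\<close> may be a valley, point 0 of
  \<open>P\<close> never is.\<close>

lemma valley_Cons_Suc: "s = U \<or> j \<noteq> 0 \<Longrightarrow> valley (s # P) (Suc j) = valley P j"
  by (cases j) (auto simp: valley_def valley_Cons_Suc_Suc)

lemma nth_filling:
  "j < length P \<Longrightarrow>
    filling P ! j = (if valley P (Suc j) then U else if valley P j then D else P ! j)"
  by (simp add: filling_def)

lemma filling_U: "filling (U # P) = U # filling P"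
proof (rule nth_equalityI)
  fix i assume "i < length (filling (U # P))"
  then show "filling (U # P) ! i = (U # filling P) ! i"
    by (cases i) (auto simp: nth_filling valley_Cons_Suc)
qed simp

lemma filling_DD: "filling (D # D # P) = D # filling (D # P)"
proof (rule nth_equalityI)
  fix i assume i: "i < length (filling (D # D # P))"
  have "\<not> valley (D # D # P) (Suc 0)"
    by (simp add: valley_def)
  then show "filling (D # D # P) ! i = (D # filling (D # P)) ! i"
    using i by (cases i; cases "i - 1") (auto simp: nth_filling valley_Cons_Suc)
qed simp

lemma filling_DU: "filling (D # U # P) = U # D # filling P"
proof (rule nth_equalityI)
  fix i assume i: "i < length (filling (D # U # P))"
  have "valley (D # U # P) (Suc 0)"
    by (simp add: valley_def)
  then show "filling (D # U # P) ! i = (U # D # filling P) ! i"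
    using i by (cases i; cases "i - 1") (auto simp: nth_filling valley_Cons_Suc)
qed simp

text \<open>Without downsteps in \<open>P\<close> the term \<open>exit_time P + 2\<close> is a
  spurious 2; it exceeds \<open>length P + 1\<close> only for \<open>P = []\<close>, hence the
  separate value there.\<close>

fun exit_time :: "path \<Rightarrow> nat" where
  "exit_time [] = 0"
| "exit_time (U # P) = exit_time P"
| "exit_time (D # P) = (if P = [] then 1 else max (length P + 1) (exit_time P + 2))"

lemma exit_time_filling: "exit_time (filling P) = exit_time P - 1"
proof (induction P rule: length_induct)
  case (1 P)
  consider "P = []" | Q where "P = U # Q" | "P = [D]" | Q where "P = D # D # Q"
    | Q where "P = D # U # Q"
    by (metis list.exhaust step.exhaust)
  then show ?case
  proof cases
    case (4 Q)
    with 1 have "exit_time (filling (D # Q)) = exit_time (D # Q) - 1"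
      by simp
    \<comment> \<open>By this bound the blocked term attains the maximum both before and after
      filling.\<close>
    moreover have "length Q + 1 \<le> exit_time (D # Q)"
      by simp
    moreover have "filling (D # Q) \<noteq> []"
      by (metis length_filling length_0_conv list.distinct(1))
    ultimately show ?thesis
      unfolding 4 filling_DD exit_time.simps(3)[of "D # Q"] exit_time.simps(3)[of "filling _"]
      by simp
  next
    case (5 Q)
    with 1 have "exit_time (filling Q) = exit_time Q - 1"
      by simp
    moreover have "filling Q = [] \<longleftrightarrow> Q = []"
      by (metis length_filling length_0_conv)
    \<comment> \<open>If \<open>exit_time Q = 0\<close>, truncated subtraction leaves the blocked
      term at 2, which \<open>length Q + 1\<close> absorbs.\<close>
    moreover have "Q \<noteq> [] \<Longrightarrow> 1 \<le> length Q"
      by (cases Q) auto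
    ultimately show ?thesis
      unfolding 5 filling_DU by auto
  qed (use 1 in \<open>auto simp: filling_Nil filling_U filling_D\<close>)
qed

lemma exit_time_eq_0_iff: "exit_time P = 0 \<longleftrightarrow> P = ones (length P)"
  by (induction P rule: exit_time.induct) (auto simp: ones_def)

lemma length_filling_funpow [simp]: "length ((filling ^^ k) P) = length P"
  by (induction k) auto

lemma exit_time_filling_funpow: "exit_time ((filling ^^ k) P) = exit_time P - k"
  by (induction k) (auto simp: exit_time_filling)

lemma degree_eq_exit_time: "degree P = exit_time P"
proof -
  have "(filling ^^ k) P = ones (length P) \<longleftrightarrow> exit_time P \<le> k" for k
    using exit_time_eq_0_iff[of "(filling ^^ k) P"] by (simp add: exit_time_filling_funpow)
  then show ?thesis
    by (simp add: degree_def Least_equality)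
qed

lemma finite_paths: "finite (paths n)"
proof -
  have "(UNIV :: step set) = {U, D}"
    using step.exhaust by auto
  then have "finite (UNIV :: step set)"
    by (metis finite.emptyI finite.insertI)
  from finite_lists_length_eq[OF this, of n] show ?thesis
    by (simp add: paths_def)
qed

lemma card_paths_Suc:
  "card {P \<in> paths (Suc n). F P} =
    card {P \<in> paths n. F (U # P)} + card {P \<in> paths n. F (D # P)}"
proof -
  have eq: "{P \<in> paths (Suc n). F P} =
      (#) U ` {P \<in> paths n. F (U # P)} \<union> (#) D ` {P \<in> paths n. F (D # P)}" (is "_ = ?A \<union> ?B")
  proof (intro equalityI subsetI)
    fix P assume "P \<in> {P \<in> paths (Suc n). F P}"
    then show "P \<in> ?A \<union> ?B"
      by (cases P; cases "hd P") (auto simp: paths_def)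
  qed (auto simp: paths_def)
  have "card (?A \<union> ?B) = card ?A + card ?B"
    by (rule card_Un_disjoint) (auto simp: finite_paths)
  then show ?thesis
    unfolding eq by (simp add: card_image)
qed

text \<open>For even \<open>n\<close> this is Pascal's rule; for odd \<open>n\<close> the two
  summands coincide, and symmetry turns one into the lower neighbour that Pascal's rule
  needs.\<close>

lemma central_binomial_step:
  "(n choose ((n + 1) div 2)) + (n choose ((n + 2) div 2)) = Suc n choose ((n + 2) div 2)"
proof (cases "even n")
  case True
  then obtain m where "n = 2 * m" by blast
  then show ?thesis by simp
next
  case False
  then obtain m where m: "n = 2 * m + 1"
    using oddE by blast
  then have "n choose m = n choose (m + 1)"
    using binomial_symmetric[of m n] by simp
  then show ?thesis
    using m by simp
qed

text \<open>Counts the paths of length \<open>n + 1\<close> with exit time at most \<open>n\<close>,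
  the leading 1 being the path without downsteps.\<close>

lemma sum_central_binomial:
  "1 + (\<Sum>j = 1..n. j choose ((j + 2) div 2)) = Suc n choose ((n + 2) div 2)"
proof (induction n)
  case (Suc n)
  then show ?case
    using central_binomial_step[of "Suc n"] by simp
qed simp

lemma card_exit_time_0: "card {P \<in> paths n. exit_time P = 0} = 1"
proof -
  have "{P \<in> paths n. exit_time P = 0} = {ones n}"
    by (auto simp: paths_def exit_time_eq_0_iff) (simp_all add: ones_def)
  then show ?thesis by simp
qed

lemma card_exit_time:
  assumes "1 \<le> n" and "1 \<le> k"
  shows "card {P \<in> paths n. exit_time P = k} = (min n k) choose ((k + 2) div 2)"
  using assms
proof (induction n arbitrary: k rule: nat_induct_at_least)
  case base
  have "{P \<in> paths 0. F P} = (if F [] then {[]} else {})" for F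
    by (auto simp: paths_def)
  then have "card {P \<in> paths 1. exit_time P = k} = (if k = 1 then 1 else 0)"
    using card_paths_Suc[of 0 "\<lambda>P. exit_time P = k"] \<open>1 \<le> k\<close> by auto
  also have "\<dots> = (min 1 k) choose ((k + 2) div 2)"
    using \<open>1 \<le> k\<close> by (auto simp: binomial_eq_0 min_def)
  finally show ?case .
next
  case (Suc n)
  define A where "A = {P \<in> paths n. exit_time (D # P) = k}"
  have A_eq: "A = {P \<in> paths n. max (n + 1) (exit_time P + 2) = k}"
    using Suc.hyps by (auto simp: A_def paths_def)
  have split: "card {P \<in> paths (Suc n). exit_time P = k} =
      (min n k choose ((k + 2) div 2)) + card A"
    using card_paths_Suc[of n "\<lambda>P. exit_time P = k"] Suc.IH[OF Suc.prems]
    by (simp add: A_def)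
  \<comment> \<open>The maximum defining \<open>A\<close> is never below \<open>n + 1\<close>; it
    equals \<open>n + 1\<close> iff \<open>exit_time P \<le> n - 1\<close>, and a larger value
    \<open>k\<close> forces \<open>exit_time P = k - 2\<close>.\<close>
  consider "k \<le> n" | "k = n + 1" | "n + 2 \<le> k" by linarith
  then show ?case
  proof cases
    case 1
    then have "A = {}"
      by (auto simp: A_eq)
    then show ?thesis
      using split 1 by simp
  next
    case 2
    have A: "A = (\<Union>j\<in>{0..n - 1}. {P \<in> paths n. exit_time P = j})"
      using 2 Suc.hyps by (auto simp: A_eq)
    have "card A = (\<Sum>j = 0..n - 1. card {P \<in> paths n. exit_time P = j})"
      unfolding A by (rule card_UN_disjoint) (auto simp: finite_paths)
    \<comment> \<open>The term \<open>j = 0\<close> is split off because the binomial formula would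
      give 0 there instead of 1.\<close>
    also have "\<dots> = 1 + (\<Sum>j = 1..n - 1. card {P \<in> paths n. exit_time P = j})"
      by (simp add: sum.atLeast_Suc_atMost card_exit_time_0)
    also have "(\<Sum>j = 1..n - 1. card {P \<in> paths n. exit_time P = j}) =
        (\<Sum>j = 1..n - 1. j choose ((j + 2) div 2))"
      by (rule sum.cong) (auto simp: Suc.IH min_def)
    also have "1 + \<dots> = n choose ((n + 1) div 2)"
      using sum_central_binomial[of "n - 1"] Suc.hyps by simp
    \<comment> \<open>Pascal's rule applies, as \<open>(k + 2) div 2\<close> is one more than
      \<open>(n + 1) div 2\<close>.\<close>
    finally show ?thesis
      using split 2 by simp
  next
    case 3
    then obtain m where m: "k = m + 2" "n \<le> m"
      by (intro that[of "k - 2"]) auto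
    then have "A = {P \<in> paths n. exit_time P = m}"
      by (auto simp: A_eq)
    \<comment> \<open>The induction hypothesis is used at \<open>k - 2\<close>, where the lower
      index is \<open>k div 2\<close>, one less than at \<open>k\<close>.\<close>
    then have "card A = n choose (k div 2)"
      using Suc.IH[of m] m Suc.hyps by simp
    then show ?thesis
      using split 3 by (simp add: min_def)
  qed
qed

theorem proposition5:
  fixes n k :: nat
  assumes "1 \<le> n" and "1 \<le> k" and "k \<le> 2 * n - 1"
  shows "card {P \<in> paths n. degree P = k} = (min n k) choose ((k + 2) div 2)"
  using card_exit_time[OF assms(1,2)] by (simp add: degree_eq_exit_time)

end
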